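(* Let $\varphi := \forall \vec{x}_1 \exists \vec{y}_1 \ldots \forall \vec{x}_n \exists \vec{y}_n.\,\psi$ be a satisfiable GBSR sentence in standard form with quantifier-free $\psi$, let $\mathrm{At}_0,\ldots,\mathrm{At}_n$ be a partition of its atoms witnessing membership in GBSR, and suppose the degree $\partial_\varphi$ (with respect to this partition) satisfies $\partial_\varphi\ge 1$. Then $\varphi$ has a model with at most $\mathrm{len}(\varphi)^2\cdot\bigl(\mathrm{twoup}_{\partial_\varphi+1}(\mathrm{len}(\varphi))\bigr)^{n^2}$ domain elements.
   Context: A first-order sentence $\varphi$ is in standard form if $\varphi = \forall \vec{x}_1 \exists \vec{y}_1 \ldots \forall \vec{x}_n \exists \vec{y}_n.\,\psi$, where the $\vec{x}_i,\vec{y}_i$ are tuples of variables ($\vec{x}_1$ and $\vec{y}_n$ may be empty), $\psi$ is quantifier-free, in negation normal form and uses only $\wedge,\vee,\neg$, every variable bound in the prefix occurs in $\psi$, and no variable is bound twice. Write $\vec{x} := \vec{x}_1\cup\ldots\cup\vec{x}_n$, $\vec{y}:=\vec{y}_1\cup\ldots\cup\vec{y}_n$, let $\mathrm{At}$ be the set of atoms of $\varphi$, and $\mathrm{vars}(S)$ the set of variables occurring in a set $S$ of atoms. A sentence in standard form that may contain equality and constant symbols but no non-constant function symbols belongs to GBSR iff $\mathrm{At}$ can be partitioned into (possibly empty) sets $\mathrm{At}_0,\ldots,\mathrm{At}_n$ such that (i) $\mathrm{vars}(\mathrm{At}_i)\subseteq \vec{y}_1\cup\ldots\cup\vec{y}_i\cup\vec{x}_{i+1}\cup\ldots\cup\vec{x}_n$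 for all $0\le i\le n$, and (ii) $\mathrm{vars}(\mathrm{At}_i)\cap\mathrm{vars}(\mathrm{At}_j)\cap\vec{x}=\emptyset$ for all $0\le i<j\le n$. Given such a partition, the degree $\partial_\varphi$ of $\varphi$ is the smallest positive integer $\kappa$ such that for every $\mathrm{At}_i$ with $0\le i<n$ there are at most $\kappa$ distinct indices $i+1<j_1<\ldots<j_\kappa\le n$ with $\vec{x}_{j_\ell}\cap\mathrm{vars}(\mathrm{At}_i)\neq\emptyset$. Tetration: $\mathrm{twoup}_0(m):=m$ and $\mathrm{twoup}_{k+1}(m):=2^{\mathrm{twoup}_k(m)}$. $\mathrm{len}(\varphi)$ denotes the length (number of symbols) of $\varphi$. *)

theory Defs
  imports Main
begin

datatype ('v, 'c) trm = Var 'v | Const 'c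

datatype ('v, 'c, 'p) atm =
    Rel 'p "('v, 'c) trm list"
  | Eq "('v, 'c) trm" "('v, 'c) trm"

datatype ('v, 'c, 'p) fm =
    Atom "('v, 'c, 'p) atm"
  | Neg "('v, 'c, 'p) fm"
  | And "('v, 'c, 'p) fm" "('v, 'c, 'p) fm"
  | Or "('v, 'c, 'p) fm" "('v, 'c, 'p) fm"
  | Forall 'v "('v, 'c, 'p) fm"
  | Exists 'v "('v, 'c, 'p) fm"


record ('c, 'p, 'a) interp =
  domain :: "'a set"
  const_val :: "'c \<Rightarrow> 'a"
  rel_val :: "'p \<Rightarrow> 'a list \<Rightarrow> bool"

definition wf_interp :: "('c, 'p, 'a) interp \<Rightarrow> bool" where
  "wf_interp M \<longleftrightarrow> domain M \<noteq> {} \<and> (\<forall>c. const_val M c \<in> domain M)"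

fun trm_val :: "('c, 'p, 'a) interp \<Rightarrow> ('v \<Rightarrow> 'a) \<Rightarrow> ('v, 'c) trm \<Rightarrow> 'a" where
  "trm_val M e (Var v) = e v"
| "trm_val M e (Const c) = const_val M c"

fun atm_holds :: "('c, 'p, 'a) interp \<Rightarrow> ('v \<Rightarrow> 'a) \<Rightarrow> ('v, 'c, 'p) atm \<Rightarrow> bool" where
  "atm_holds M e (Rel p ts) \<longleftrightarrow> rel_val M p (map (trm_val M e) ts)"
| "atm_holds M e (Eq s t) \<longleftrightarrow> trm_val M e s = trm_val M e t"

fun sat :: "('c, 'p, 'a) interp \<Rightarrow> ('v \<Rightarrow> 'a) \<Rightarrow> ('v, 'c, 'p) fm \<Rightarrow> bool" where
  "sat M e (Atom a) \<longleftrightarrow> atm_holds M e a"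
| "sat M e (Neg f) \<longleftrightarrow> \<not> sat M e f"
| "sat M e (And f g) \<longleftrightarrow> sat M e f \<and> sat M e g"
| "sat M e (Or f g) \<longleftrightarrow> sat M e f \<or> sat M e g"
| "sat M e (Forall v f) \<longleftrightarrow> (\<forall>a\<in>domain M. sat M (e(v := a)) f)"
| "sat M e (Exists v f) \<longleftrightarrow> (\<exists>a\<in>domain M. sat M (e(v := a)) f)"

definition is_model :: "('c, 'p, 'a) interp \<Rightarrow> ('v, 'c, 'p) fm \<Rightarrow> bool" where
  "is_model M f \<longleftrightarrow> wf_interp M \<and> (\<forall>e. range e \<subseteq> domain M \<longrightarrow> sat M e f)"


fun trm_vars :: "('v, 'c) trm \<Rightarrow> 'v set" where
  "trm_vars (Var v) = {v}"
| "trm_vars (Const c) = {}"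

fun atm_vars :: "('v, 'c, 'p) atm \<Rightarrow> 'v set" where
  "atm_vars (Rel p ts) = (\<Union>t\<in>set ts. trm_vars t)"
| "atm_vars (Eq s t) = trm_vars s \<union> trm_vars t"

definition vars :: "('v, 'c, 'p) atm set \<Rightarrow> 'v set" where
  "vars S = (\<Union>a\<in>S. atm_vars a)"

fun atoms :: "('v, 'c, 'p) fm \<Rightarrow> ('v, 'c, 'p) atm set" where
  "atoms (Atom a) = {a}"
| "atoms (Neg f) = atoms f"
| "atoms (And f g) = atoms f \<union> atoms g"
| "atoms (Or f g) = atoms f \<union> atoms g"
| "atoms (Forall v f) = atoms f"
| "atoms (Exists v f) = atoms f"

text \<open>The length counts every occurrence of a quantifier, connective, predicate symbol,
  equality sign, constant symbol and variable (including the variable directly after a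
  quantifier). Auxiliary punctuation is not counted.\<close>

fun atm_len :: "('v, 'c, 'p) atm \<Rightarrow> nat" where
  "atm_len (Rel p ts) = 1 + length ts"
| "atm_len (Eq s t) = 3"

fun len :: "('v, 'c, 'p) fm \<Rightarrow> nat" where
  "len (Atom a) = atm_len a"
| "len (Neg f) = 1 + len f"
| "len (And f g) = 1 + len f + len g"
| "len (Or f g) = 1 + len f + len g"
| "len (Forall v f) = 2 + len f"
| "len (Exists v f) = 2 + len f"

fun qf_nnf :: "('v, 'c, 'p) fm \<Rightarrow> bool" where
  "qf_nnf (Atom a) \<longleftrightarrow> True"
| "qf_nnf (Neg f) \<longleftrightarrow> (\<exists>a. f = Atom a)"
| "qf_nnf (And f g) \<longleftrightarrow> qf_nnf f \<and> qf_nnf g"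
| "qf_nnf (Or f g) \<longleftrightarrow> qf_nnf f \<and> qf_nnf g"
| "qf_nnf (Forall v f) \<longleftrightarrow> False"
| "qf_nnf (Exists v f) \<longleftrightarrow> False"


text \<open>A quantifier prefix is given by two families \<open>X\<close>, \<open>Y\<close> of tuples, of which only the
  indices \<open>1..n\<close> matter.\<close>

definition prenex ::
  "nat \<Rightarrow> (nat \<Rightarrow> 'v list) \<Rightarrow> (nat \<Rightarrow> 'v list) \<Rightarrow> ('v, 'c, 'p) fm \<Rightarrow> ('v, 'c, 'p) fm" where
  "prenex n X Y \<psi> =
     foldr (\<lambda>i f. foldr Forall (X i) (foldr Exists (Y i) f)) [1..<Suc n] \<psi>"

definition bound_vars :: "nat \<Rightarrow> (nat \<Rightarrow> 'v list) \<Rightarrow> (nat \<Rightarrow> 'v list) \<Rightarrow> 'v list" where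
  "bound_vars n X Y = concat (map (\<lambda>i. X i @ Y i) [1..<Suc n])"

text \<open>In the last conjunct, the inclusion from right to left says that \<open>prenex n X Y \<psi>\<close> is a
  sentence, the other one that every variable of the prefix occurs in \<open>\<psi>\<close>.
  Only the first universal and the last existential tuple may be empty.\<close>

definition standard_form ::
  "nat \<Rightarrow> (nat \<Rightarrow> 'v list) \<Rightarrow> (nat \<Rightarrow> 'v list) \<Rightarrow> ('v, 'c, 'p) fm \<Rightarrow> bool" where
  "standard_form n X Y \<psi> \<longleftrightarrow>
     1 \<le> n \<and>
     (\<forall>i\<in>{2..n}. X i \<noteq> []) \<and>
     (\<forall>i\<in>{1..<n}. Y i \<noteq> []) \<and>
     qf_nnf \<psi> \<and>
     distinct (bound_vars n X Y) \<and>
     set (bound_vars n X Y) = vars (atoms \<psi>)"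

definition gbsr_partition ::
  "nat \<Rightarrow> (nat \<Rightarrow> 'v list) \<Rightarrow> (nat \<Rightarrow> 'v list) \<Rightarrow> ('v, 'c, 'p) fm
     \<Rightarrow> (nat \<Rightarrow> ('v, 'c, 'p) atm set) \<Rightarrow> bool" where
  "gbsr_partition n X Y \<psi> At \<longleftrightarrow>
     (\<Union>i\<in>{0..n}. At i) = atoms \<psi> \<and>
     (\<forall>i j. i < j \<and> j \<le> n \<longrightarrow> At i \<inter> At j = {}) \<and>
     (\<forall>i\<in>{0..n}. vars (At i) \<subseteq> (\<Union>k\<in>{1..i}. set (Y k)) \<union> (\<Union>k\<in>{i+1..n}. set (X k))) \<and>
     (\<forall>i j. i < j \<and> j \<le> n \<longrightarrow>
        vars (At i) \<inter> vars (At j) \<inter> (\<Union>k\<in>{1..n}. set (X k)) = {})"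

definition degree ::
  "nat \<Rightarrow> (nat \<Rightarrow> 'v list) \<Rightarrow> (nat \<Rightarrow> ('v, 'c, 'p) atm set) \<Rightarrow> nat" where
  "degree n X At =
     (LEAST \<kappa>. 1 \<le> \<kappa> \<and>
        (\<forall>i<n. card {j. i + 1 < j \<and> j \<le> n \<and> set (X j) \<inter> vars (At i) \<noteq> {}} \<le> \<kappa>))"

fun twoup :: "nat \<Rightarrow> nat \<Rightarrow> nat" where
  "twoup 0 m = m"
| "twoup (Suc k) m = 2 ^ twoup k m"

end

theory Submission
  imports Defs "HOL-Library.Countable_Set" "HOL-Library.Nat_Bijection" "HOL-Library.FuncSet"
begin

text \<open>View the truth of the sentence in \<open>M\<close> as a game. Once \<open>y\<^sub>1, \<dots>, y\<^sub>i\<close> are chosen, the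
  atoms in \<open>At i\<close> depend only on universal variables, and these occur in no other class.
  So the future of a position after round \<open>k\<close> depends only on the values of \<open>y\<^sub>1, \<dots>, y\<^sub>k\<close> and, for
  every \<open>i < k\<close>, on the game-theoretic type (fingerprint) of \<open>At i\<close>; there are at most
  \<open>twoup (\<partial> + 1) len\<close> of the latter. Player \<open>\<exists>\<close> can therefore answer by fingerprints only, so
  that round \<open>k\<close> multiplies the number of positions by at most \<open>(twoup (\<partial> + 1) len) ^ k\<close>, and
  the submodel of all answers and constants still satisfies the sentence.\<close>

section \<open>Blocks of equal quantifiers and truth of atoms\<close>

text \<open>A whole tuple is reassigned at once, so that a block of equal quantifiers becomes one
  move of the game.\<close>

definition variant :: "'a set \<Rightarrow> 'v list \<Rightarrow> ('v \<Rightarrow> 'a) \<Rightarrow> ('v \<Rightarrow> 'a) \<Rightarrow> bool" where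
  "variant D xs e e' \<longleftrightarrow> (\<forall>v. v \<notin> set xs \<longrightarrow> e' v = e v) \<and> (\<forall>v\<in>set xs. e' v \<in> D)"

lemma variant_Nil [simp]: "variant D [] e e' \<longleftrightarrow> e' = e"
  by (auto simp: variant_def)

lemma variant_Cons:
  "variant D (x # xs) e e' \<longleftrightarrow> (\<exists>a\<in>D. variant D xs (e(x := a)) e')"
proof
  assume v: "variant D (x # xs) e e'"
  then have "e' x \<in> D" "variant D xs (e(x := e' x)) e'"
    by (auto simp: variant_def)
  then show "\<exists>a\<in>D. variant D xs (e(x := a)) e'" by blast
next
  assume "\<exists>a\<in>D. variant D xs (e(x := a)) e'"
  then obtain a where "a \<in> D" "variant D xs (e(x := a)) e'" by blast
  \<comment> \<open>If \<open>x\<close> occurs again in \<open>xs\<close>, the value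
    \<open>a\<close> is overwritten, and membership in \<open>D\<close> comes from the tail.\<close>
  then show "variant D (x # xs) e e'"
    by (cases "x \<in> set xs") (auto simp: variant_def)
qed

lemma sat_foldr_Forall:
  "sat M e (foldr Forall xs f) \<longleftrightarrow> (\<forall>e'. variant (domain M) xs e e' \<longrightarrow> sat M e' f)"
  by (induction xs arbitrary: e) (auto simp: variant_Cons)

lemma sat_foldr_Exists:
  "sat M e (foldr Exists xs f) \<longleftrightarrow> (\<exists>e'. variant (domain M) xs e e' \<and> sat M e' f)"
  by (induction xs arbitrary: e) (auto simp: variant_Cons)

lemma sat_qf_cong:
  assumes "qf_nnf f" "\<And>a. a \<in> atoms f \<Longrightarrow> atm_holds M e a \<longleftrightarrow> atm_holds M' e' a"
  shows "sat M e f \<longleftrightarrow> sat M' e' f"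
  using assms by (induction f) auto

lemma trm_val_cong: "(\<And>v. v \<in> trm_vars u \<Longrightarrow> e v = e' v) \<Longrightarrow> trm_val M e u = trm_val M e' u"
  by (cases u) auto

lemma atm_holds_cong:
  assumes "\<And>v. v \<in> atm_vars a \<Longrightarrow> e v = e' v"
  shows "atm_holds M e a \<longleftrightarrow> atm_holds M e' a"
proof (cases a)
  case (Rel p ts)
  then have "map (trm_val M e) ts = map (trm_val M e') ts"
    using assms by (auto intro!: trm_val_cong)
  then show ?thesis by (simp only: Rel atm_holds.simps)
next
  case (Eq s u)
  then show ?thesis using assms trm_val_cong[of s e e' M] trm_val_cong[of u e e' M] by auto
qed

text \<open>Relations are inherited from \<open>M\<close>, so an atom does not notice the smaller
  domain. Only its own constants must keep their values; the others are free to be moved into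
  \<open>D\<close>.\<close>

lemma atm_holds_restrict:
  assumes "\<And>c. c \<in> set2_atm a \<Longrightarrow> cv c = const_val M c"
  shows "atm_holds (M\<lparr>domain := D, const_val := cv\<rparr>) e a \<longleftrightarrow> atm_holds M e a"
proof -
  have tv: "trm_val (M\<lparr>domain := D, const_val := cv\<rparr>) e u = trm_val M e u"
    if "\<And>c. c \<in> set2_trm u \<Longrightarrow> cv c = const_val M c" for u
    using that by (cases u) auto
  show ?thesis
  proof (cases a)
    case (Rel p ts)
    then have "map (trm_val (M\<lparr>domain := D, const_val := cv\<rparr>) e) ts = map (trm_val M e) ts"
      using assms by (auto intro!: tv)
    then show ?thesis by (simp add: Rel del: map_eq_conv)
  next
    case (Eq s u)
    then show ?thesis using assms tv[of s] tv[of u] by auto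
  qed
qed

section \<open>Counting atoms and constants by the length\<close>

lemma set2_atm_atoms: "a \<in> atoms f \<Longrightarrow> set2_atm a \<subseteq> set2_fm f"
  by (induction f) auto

lemma finite_atoms: "finite (atoms f)"
  by (induction f) auto

lemma atm_len_pos: "1 \<le> atm_len a"
  by (cases a) auto

lemma card_atoms_le_len: "card (atoms f) \<le> len f"
proof (induction f)
  case (And f g)
  then show ?case using card_Un_le[of "atoms f" "atoms g"] by simp
next
  case (Or f g)
  then show ?case using card_Un_le[of "atoms f" "atoms g"] by simp
qed (use atm_len_pos in auto)

lemma trm_consts: "finite (set2_trm u)" "card (set2_trm u) \<le> 1"
  by (cases u; simp)+

text \<open>The predicate or equality sign adds to the length but not to the constants, hence the
  strict inequality.\<close>

lemma atm_consts: "finite (set2_atm a)" "card (set2_atm a) < atm_len a"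
proof -
  have "finite (set2_atm a) \<and> card (set2_atm a) < atm_len a"
  proof (cases a)
    case (Rel p ts)
    have "card (\<Union>u\<in>set ts. set2_trm u) \<le> (\<Sum>u\<in>set ts. card (set2_trm u))"
      by (rule card_UN_le) simp
    also have "\<dots> \<le> (\<Sum>u\<in>set ts. 1)" by (rule sum_mono) (rule trm_consts)
    also have "\<dots> \<le> length ts" by (simp add: card_length)
    finally show ?thesis by (auto simp: Rel trm_consts)
  next
    case (Eq s u)
    then show ?thesis
      using card_Un_le[of "set2_trm s" "set2_trm u"] trm_consts(2)[of s] trm_consts(2)[of u]
      by (auto simp: trm_consts)
  qed
  then show "finite (set2_atm a)" "card (set2_atm a) < atm_len a" by auto
qed

lemma finite_fm_consts: "finite (set2_fm f)"
  by (induction f) (auto simp: atm_consts)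

text \<open>Strictness is inherited from the atoms; the unit gained pays for one default element of
  the final domain.\<close>

lemma card_fm_consts_less_len: "card (set2_fm f) < len f"
proof (induction f)
  case (And f g)
  then show ?case using card_Un_le[of "set2_fm f" "set2_fm g"] by simp
next
  case (Or f g)
  then show ?case using card_Un_le[of "set2_fm f" "set2_fm g"] by simp
qed (auto simp: atm_consts)

section \<open>Invariance under isomorphism\<close>

lemma sat_isomorphic:
  assumes "bij_betw g (domain N) (domain M)"
    and "\<And>c. const_val N c \<in> domain N" "\<And>c. g (const_val N c) = const_val M c"
    and "\<And>p as. rel_val N p as \<longleftrightarrow> rel_val M p (map g as)"
    and "range e \<subseteq> domain N"
  shows "sat N e f \<longleftrightarrow> sat M (\<lambda>v. g (e v)) f"
  using assms(5)
proof (induction f arbitrary: e)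
  case (Atom a)
  have tv: "trm_val M (\<lambda>v. g (e v)) u = g (trm_val N e u)" "trm_val N e u \<in> domain N" for u
    using assms(2,3) Atom by (cases u; auto)+
  have "inj_on g (domain N)" using assms(1) by (rule bij_betw_imp_inj_on)
  then have eq: "g (trm_val N e s) = g (trm_val N e u) \<longleftrightarrow> trm_val N e s = trm_val N e u" for s u
    using tv(2) by (simp add: inj_on_eq_iff)
  have "trm_val M (\<lambda>v. g (e v)) = (\<lambda>u. g (trm_val N e u))"
    using tv(1) by auto
  then show ?case using assms(4) eq by (cases a) (simp_all add: comp_def)
next
  case (Forall v f)
  have "sat N (e(v := a)) f \<longleftrightarrow> sat M ((\<lambda>w. g (e w))(v := g a)) f" if "a \<in> domain N" for a
  proof -
    have "range (e(v := a)) \<subseteq> domain N" using Forall.prems that by auto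
    moreover have "(\<lambda>w. g ((e(v := a)) w)) = (\<lambda>w. g (e w))(v := g a)" by auto
    ultimately show ?thesis using Forall.IH by metis
  qed
  moreover have "domain M = g ` domain N" using assms(1) by (simp add: bij_betw_def)
  ultimately show ?case by auto
next
  case (Exists v f)
  have "sat N (e(v := a)) f \<longleftrightarrow> sat M ((\<lambda>w. g (e w))(v := g a)) f" if "a \<in> domain N" for a
  proof -
    have "range (e(v := a)) \<subseteq> domain N" using Exists.prems that by auto
    moreover have "(\<lambda>w. g ((e(v := a)) w)) = (\<lambda>w. g (e w))(v := g a)" by auto
    ultimately show ?thesis using Exists.IH by metis
  qed
  moreover have "domain M = g ` domain N" using assms(1) by (simp add: bij_betw_def)
  ultimately show ?case by auto
qed auto

section \<open>Tetration and codes of finite sets\<close>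

lemma twoup_exp: "twoup k (2 ^ m) = twoup (Suc k) m"
  by (induction k) auto

lemma twoup_mono: "m \<le> m' \<Longrightarrow> twoup k m \<le> twoup k m'"
  by (induction k) auto

lemma twoup_le_Suc: "twoup k m \<le> twoup (Suc k) m"
  using less_exp[of "twoup k m"] by simp

lemma twoup_mono_index: "k \<le> k' \<Longrightarrow> twoup k m \<le> twoup k' m"
  using twoup_le_Suc by (rule lift_Suc_mono_le)

lemma set_encode_less:
  assumes "S \<subseteq> {..<m}"
  shows "set_encode S < 2 ^ m"
proof -
  have "set_encode S \<le> (\<Sum>i<m. 2 ^ i)"
    unfolding set_encode_def by (rule sum_mono2) (use assms in auto)
  also have "\<dots> < 2 ^ m" by (induction m) auto
  finally show ?thesis .
qed

section \<open>Fingerprints of assignments\<close>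

text \<open>The type of an assignment records, hereditarily, which types the atoms \<open>A\<close> can still
  attain when the blocks of variables still to come are chosen one after the other. Blocks that
  do not meet \<open>A\<close> are skipped, so that they do not cost an exponential. Sets of types are
  encoded as numbers because their nesting depth varies.\<close>

fun fingerprint :: "('c, 'p, 'a) interp \<Rightarrow> ('v, 'c, 'p) atm set \<Rightarrow> 'v list list \<Rightarrow> ('v \<Rightarrow> 'a) \<Rightarrow> nat" where
  "fingerprint M A [] e = set_encode (to_nat_on A ` {a \<in> A. atm_holds M e a})"
| "fingerprint M A (xs # xss) e =
     (if set xs \<inter> vars A = {} then fingerprint M A xss e
      else set_encode (fingerprint M A xss ` Collect (variant (domain M) xs e)))"

text \<open>Variables of \<open>A\<close> in blocks still to come are overwritten before any atom is
  evaluated, and a block is skipped only if it contains none of them. Hence only the variables of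
  \<open>A\<close> already fixed matter.\<close>

lemma fingerprint_cong:
  assumes "\<And>v. v \<in> vars A \<Longrightarrow> v \<notin> \<Union>(set ` set xss) \<Longrightarrow> e v = e' v"
  shows "fingerprint M A xss e = fingerprint M A xss e'"
  using assms
proof (induction xss arbitrary: e e')
  case Nil
  then have "atm_holds M e a \<longleftrightarrow> atm_holds M e' a" if "a \<in> A" for a
    using that by (intro atm_holds_cong) (auto simp: vars_def)
  then have "{a \<in> A. atm_holds M e a} = {a \<in> A. atm_holds M e' a}" by auto
  then show ?case by simp
next
  case (Cons xs xss)
  have sub: "fingerprint M A xss ` Collect (variant (domain M) xs e1)
      \<subseteq> fingerprint M A xss ` Collect (variant (domain M) xs e2)"
    if eq: "\<And>v. v \<in> vars A \<Longrightarrow> v \<notin> \<Union>(set ` set (xs # xss)) \<Longrightarrow> e1 v = e2 v" for e1 e2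
  proof (rule image_subsetI)
    fix f assume "f \<in> Collect (variant (domain M) xs e1)"
    then have f: "variant (domain M) xs e1 f" by simp
    let ?f = "\<lambda>v. if v \<in> set xs then f v else e2 v"
    have "variant (domain M) xs e2 ?f" using f by (auto simp: variant_def)
    moreover have "fingerprint M A xss f = fingerprint M A xss ?f"
      by (rule Cons.IH) (use f eq in \<open>auto simp: variant_def\<close>)
    ultimately show "fingerprint M A xss f \<in> fingerprint M A xss ` Collect (variant (domain M) xs e2)" by blast
  qed
  show ?case
  proof (cases "set xs \<inter> vars A = {}")
    case True
    then have "fingerprint M A xss e = fingerprint M A xss e'"
      by (intro Cons.IH) (use Cons.prems in auto)
    then show ?thesis using True by simp
  next
    case False
    have "fingerprint M A xss ` Collect (variant (domain M) xs e)
      = fingerprint M A xss ` Collect (variant (domain M) xs e')"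
      using sub[of e e'] sub[of e' e] Cons.prems by (metis subset_antisym)
    then show ?thesis using False by simp
  qed
qed

text \<open>With no block left, a subset of \<open>A\<close> is coded, which gives
  \<open>2 ^ card A\<close> values. Every block that meets \<open>A\<close> passes to sets of codes
  and costs one exponential.\<close>

lemma fingerprint_less:
  assumes "finite A"
  shows "fingerprint M A xss e
    < twoup (length (filter (\<lambda>xs. set xs \<inter> vars A \<noteq> {}) xss)) (2 ^ card A)"
proof (induction xss arbitrary: e)
  case Nil
  have "to_nat_on A ` A = {..<card A}"
    using to_nat_on_finite[OF assms] by (simp add: bij_betw_def)
  then have "to_nat_on A ` {a \<in> A. atm_holds M e a} \<subseteq> {..<card A}" by blast
  then show ?case using set_encode_less by simp
next
  case (Cons xs xss)
  have "fingerprint M A xss ` S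
      \<subseteq> {..<twoup (length (filter (\<lambda>xs. set xs \<inter> vars A \<noteq> {}) xss)) (2 ^ card A)}" for S
    using Cons.IH by auto
  then show ?case using Cons.IH set_encode_less by auto
qed

lemma fingerprint_Nil_eqD:
  assumes "fingerprint M A [] e = fingerprint M A [] e'" "finite A" "a \<in> A"
  shows "atm_holds M e a \<longleftrightarrow> atm_holds M e' a"
proof -
  have "to_nat_on A ` {a \<in> A. atm_holds M e a} = to_nat_on A ` {a \<in> A. atm_holds M e' a}"
    using assms(1,2) by (simp add: set_encode_eq)
  moreover have "inj_on (to_nat_on A) A"
    using to_nat_on_finite[OF assms(2)] by (rule bij_betw_imp_inj_on)
  ultimately have "{a \<in> A. atm_holds M e a} = {a \<in> A. atm_holds M e' a}"
    by (subst (asm) inj_on_image_eq_iff) auto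
  then show ?thesis using assms(3) by auto
qed

text \<open>The back-and-forth step for a single class of atoms: equal types mean equal sets of
  attainable next types, so a move from \<open>e\<close> can be matched from
  \<open>p\<close>.\<close>

lemma fingerprint_Cons_eqD:
  assumes "fingerprint M A (xs # xss) e = fingerprint M A (xs # xss) p" "finite A" "variant (domain M) xs e e'"
  obtains p' where "variant (domain M) xs p p'" "fingerprint M A xss p' = fingerprint M A xss e'"
proof (cases "set xs \<inter> vars A = {}")
  case True
  \<comment> \<open>A skipped block is invisible to \<open>A\<close>, so copying the move keeps the
    fingerprint.\<close>
  let ?p = "\<lambda>v. if v \<in> set xs then e' v else p v"
  have "variant (domain M) xs p ?p" using assms(3) by (auto simp: variant_def)
  moreover have "fingerprint M A xss ?p = fingerprint M A xss p"
    by (rule fingerprint_cong) (use True in auto)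
  moreover have "fingerprint M A xss e' = fingerprint M A xss e"
    by (rule fingerprint_cong) (use True assms(3) in \<open>auto simp: variant_def\<close>)
  ultimately show ?thesis using assms(1) True that by auto
next
  case False
  \<comment> \<open>\<open>set_encode\<close> is injective only on finite sets. There may be
    infinitely many moves, but they attain finitely many fingerprints.\<close>
  have fin: "finite (fingerprint M A xss ` S)" for S
    by (rule finite_subset[of _ "{..<twoup (length (filter (\<lambda>xs. set xs \<inter> vars A \<noteq> {}) xss))
        (2 ^ card A)}"]) (use fingerprint_less[OF assms(2)] in auto)
  have "fingerprint M A xss ` Collect (variant (domain M) xs e)
      = fingerprint M A xss ` Collect (variant (domain M) xs p)"
    using assms(1) False fin by (simp add: set_encode_eq)
  then have "fingerprint M A xss e' \<in> fingerprint M A xss ` Collect (variant (domain M) xs p)"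
    using assms(3) by blast
  then show ?thesis using that by auto
qed

section \<open>The prefix after some rounds, the degree, disjointness of tuples\<close>

definition prenex_from ::
  "nat \<Rightarrow> nat \<Rightarrow> (nat \<Rightarrow> 'v list) \<Rightarrow> (nat \<Rightarrow> 'v list) \<Rightarrow> ('v, 'c, 'p) fm \<Rightarrow> ('v, 'c, 'p) fm" where
  "prenex_from k n X Y \<psi> =
     foldr (\<lambda>i f. foldr Forall (X i) (foldr Exists (Y i) f)) [Suc k..<Suc n] \<psi>"

lemma prenex_from_0: "prenex_from 0 n X Y \<psi> = prenex n X Y \<psi>"
  by (simp add: prenex_from_def prenex_def)

lemma prenex_from_self: "prenex_from n n X Y \<psi> = \<psi>"
  by (simp add: prenex_from_def)

lemma prenex_from_less:
  assumes "k < n"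
  shows "prenex_from k n X Y \<psi> =
    foldr Forall (X (Suc k)) (foldr Exists (Y (Suc k)) (prenex_from (Suc k) n X Y \<psi>))"
  using assms by (simp add: prenex_from_def upt_conv_Cons del: upt_Suc)

lemma len_foldr_quantifier:
  "len (foldr Forall xs f) = 2 * length xs + len f"
  "len (foldr Exists xs f) = 2 * length xs + len f"
  by (induction xs) auto

text \<open>Existential variables will pay for the answers and the matrix for the constants; both
  are covered by one length.\<close>

lemma len_prenex_from:
  assumes "k \<le> n"
  shows "(\<Sum>j\<in>{Suc k..n}. length (Y j)) + len \<psi> \<le> len (prenex_from k n X Y \<psi>)"
  using assms
proof (induction k rule: inc_induct)
  case base
  then show ?case by (simp add: prenex_from_self)
next
  case (step k)
  have "{Suc k..n} = insert (Suc k) {Suc (Suc k)..n}" using step by auto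
  then show ?case using step by (simp add: prenex_from_less len_foldr_quantifier)
qed

lemma degree_card_le:
  assumes "i < n"
  shows "card {j. i + 1 < j \<and> j \<le> n \<and> set (X j) \<inter> vars (At i) \<noteq> {}} \<le> degree n X At"
proof -
  let ?P = "\<lambda>\<kappa>. 1 \<le> \<kappa> \<and>
        (\<forall>i<n. card {j. i + 1 < j \<and> j \<le> n \<and> set (X j) \<inter> vars (At i) \<noteq> {}} \<le> \<kappa>)"
  have "card {j. i + 1 < j \<and> j \<le> n \<and> set (X j) \<inter> vars (At i) \<noteq> {}} \<le> Suc n" for i
    using card_mono[of "{..n}" "{j. i + 1 < j \<and> j \<le> n \<and> set (X j) \<inter> vars (At i) \<noteq> {}}"]
    by auto
  \<comment> \<open>\<open>LEAST\<close> is meaningful only if some candidate exists;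
    \<open>Suc n\<close> is one.\<close>
  then have "?P (Suc n)" by simp
  then have "?P (degree n X At)" unfolding degree_def by (rule LeastI)
  then show ?thesis using assms by blast
qed

lemma distinct_concat_upt_block:
  assumes "distinct (concat (map f [a..<b]))" "i \<in> {a..<b}"
  shows "distinct (f i)"
  using assms by (induction b) (auto simp: less_Suc_eq)

lemma distinct_concat_upt_disjoint:
  assumes "distinct (concat (map f [a..<b]))" "i \<in> {a..<b}" "j \<in> {a..<b}" "i \<noteq> j"
  shows "set (f i) \<inter> set (f j) = {}"
  using assms
proof (induction b)
  case (Suc b)
  then have "distinct (concat (map f [a..<b]))"
    "(\<Union>l\<in>{a..<b}. set (f l)) \<inter> set (f b) = {}"
    by auto
  with Suc show ?case by (cases "i = b"; cases "j = b") fastforce+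
qed simp

section \<open>GBSR partitions and the number of fingerprints\<close>

locale gbsr =
  fixes n :: nat
    and X Y :: "nat \<Rightarrow> 'v list"
    and \<psi> :: "('v, 'c, 'p) fm"
    and At :: "nat \<Rightarrow> ('v, 'c, 'p) atm set"
    and M :: "('c, 'p, 'a) interp"
  assumes standard: "standard_form n X Y \<psi>"
    and partition: "gbsr_partition n X Y \<psi> At"
begin

abbreviation blocks :: "nat \<Rightarrow> 'v list list" where
  "blocks k \<equiv> map X [Suc k..<Suc n]"

lemma blocks_less: "k < n \<Longrightarrow> blocks k = X (Suc k) # blocks (Suc k)"
  by (simp add: upt_conv_Cons del: upt_Suc)

lemma Union_blocks: "\<Union>(set ` set (blocks k)) = (\<Union>j\<in>{Suc k..n}. set (X j))"
  by (simp add: atLeastLessThanSuc_atLeastAtMost del: upt_Suc)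

lemma Un_At: "(\<Union>i\<in>{0..n}. At i) = atoms \<psi>"
  using partition by (simp add: gbsr_partition_def)

lemma At_subset: "i \<le> n \<Longrightarrow> At i \<subseteq> atoms \<psi>"
  using Un_At by auto

lemma finite_At: "i \<le> n \<Longrightarrow> finite (At i)"
  using At_subset finite_atoms finite_subset by metis

lemma vars_At:
  "i \<le> n \<Longrightarrow> vars (At i) \<subseteq> (\<Union>j\<in>{1..i}. set (Y j)) \<union> (\<Union>j\<in>{Suc i..n}. set (X j))"
  using partition by (auto simp: gbsr_partition_def)

lemma vars_At_disjoint:
  assumes "i \<le> n" "i' \<le> n" "i \<noteq> i'" "j \<in> {1..n}"
  shows "vars (At i) \<inter> vars (At i') \<inter> set (X j) = {}"
proof -
  have "vars (At i) \<inter> vars (At i') \<inter> set (X j) = {}"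
    if "i < i'" "i' \<le> n" "j \<in> {1..n}" for i i' j
    using partition that unfolding gbsr_partition_def by blast
  from this[of i i' j] this[of i' i j] assms show ?thesis by (cases i i' rule: linorder_cases) auto
qed

lemma distinct_prefix: "distinct (concat (map (\<lambda>i. X i @ Y i) [1..<Suc n]))"
  using standard unfolding standard_form_def bound_vars_def by blast

lemma X_Y_disjoint:
  assumes "i \<in> {1..n}" "j \<in> {1..n}"
  shows "set (X i) \<inter> set (Y j) = {}"
proof (cases "i = j")
  case True
  have "distinct (X i @ Y i)"
    using distinct_concat_upt_block[OF distinct_prefix, of i] assms by auto
  then show ?thesis using True by simp
next
  case False
  then show ?thesis
    using distinct_concat_upt_disjoint[OF distinct_prefix, of i j] assms by auto
qed

lemma Y_Y_disjoint:
  assumes "i \<in> {1..n}" "j \<in> {1..n}" "i \<noteq> j"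
  shows "set (Y i) \<inter> set (Y j) = {}"
  using distinct_concat_upt_disjoint[OF distinct_prefix, of i j] assms by auto

text \<open>After the universal move of round \<open>k + 1\<close>, the blocks left have index at
  least \<open>k + 2 > i + 1\<close>, so those meeting \<open>At i\<close> are among the ones
  counted by the degree. The additional storey of the tower comes from the power set of
  \<open>At i\<close>.\<close>

lemma fingerprint_bound:
  assumes "i \<le> k" "k < n" "card (atoms \<psi>) \<le> l"
  shows "fingerprint M (At i) (blocks (Suc k)) e < twoup (degree n X At + 1) l"
proof -
  let ?P = "\<lambda>j. set (X j) \<inter> vars (At i) \<noteq> {}"
  have "length (filter (\<lambda>xs. set xs \<inter> vars (At i) \<noteq> {}) (blocks (Suc k)))
      = length (filter ?P [Suc (Suc k)..<Suc n])"
    by (simp add: filter_map comp_def del: upt_Suc)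
  also have "\<dots> = card (set (filter ?P [Suc (Suc k)..<Suc n]))"
    by (rule distinct_card[symmetric]) simp
  also have "\<dots> \<le> card {j. i + 1 < j \<and> j \<le> n \<and> ?P j}"
    by (rule card_mono) (use assms in auto)
  also have "\<dots> \<le> degree n X At" by (rule degree_card_le) (use assms in simp)
  finally have d: "length (filter (\<lambda>xs. set xs \<inter> vars (At i) \<noteq> {}) (blocks (Suc k)))
      \<le> degree n X At" (is "?d \<le> _") .
  have fin: "finite (At i)" using finite_At assms by simp
  have "card (At i) \<le> card (atoms \<psi>)"
    by (rule card_mono) (use At_subset finite_atoms assms in auto)
  then have c: "card (At i) \<le> l" using assms by simp
  have "fingerprint M (At i) (blocks (Suc k)) e < twoup ?d (2 ^ card (At i))"
    using fin by (rule fingerprint_less)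
  also have "\<dots> = twoup (Suc ?d) (card (At i))" by (rule twoup_exp)
  also have "\<dots> \<le> twoup (Suc ?d) l" using c by (rule twoup_mono)
  also have "\<dots> \<le> twoup (degree n X At + 1) l" by (rule twoup_mono_index) (use d in simp)
  finally show ?thesis .
qed

section \<open>Equivalent positions of the game\<close>

text \<open>No fingerprints of \<open>At i\<close> with \<open>i \<ge> k\<close> are needed: after round \<open>k\<close>, none of its
  universal variables has been chosen yet.\<close>

definition equivalent :: "nat \<Rightarrow> ('v \<Rightarrow> 'a) \<Rightarrow> ('v \<Rightarrow> 'a) \<Rightarrow> bool" where
  "equivalent k e p \<longleftrightarrow> (\<forall>j\<in>{1..k}. \<forall>v\<in>set (Y j). e v = p v) \<and>
     (\<forall>i<k. fingerprint M (At i) (blocks k) e = fingerprint M (At i) (blocks k) p)"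

text \<open>The case \<open>i = k\<close> comes for free: each variable of \<open>At k\<close> is
  either an existential one on which the positions agree or lies in a block still to come.\<close>

lemma equivalent_fingerprint:
  assumes "equivalent k e p" "k \<le> n" "i \<le> k"
  shows "fingerprint M (At i) (blocks k) e = fingerprint M (At i) (blocks k) p"
proof (cases "i < k")
  case True
  then show ?thesis using assms by (simp add: equivalent_def del: upt_Suc)
next
  case False
  then have "i = k" using assms by simp
  have "e v = p v" if "v \<in> vars (At k)" "v \<notin> \<Union>(set ` set (blocks k))" for v
    using that vars_At[of k] assms unfolding Union_blocks equivalent_def by blast
  then show ?thesis unfolding \<open>i = k\<close> by (rule fingerprint_cong)
qed

text \<open>By the first partition condition, \<open>At i\<close> mentions existential variables
  only up to index \<open>i \<le> k\<close>, so the answer in round \<open>k + 1\<close> is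
  invisible to it.\<close>

lemma fingerprint_variant_Y:
  assumes "i \<le> k" "k < n" "variant D (Y (Suc k)) e e'"
  shows "fingerprint M (At i) xss e' = fingerprint M (At i) xss e"
proof (rule fingerprint_cong)
  fix v assume v: "v \<in> vars (At i)"
  have "v \<notin> set (Y (Suc k))"
  proof
    assume *: "v \<in> set (Y (Suc k))"
    have "vars (At i) \<subseteq> (\<Union>j\<in>{1..i}. set (Y j)) \<union> (\<Union>j\<in>{Suc i..n}. set (X j))"
      by (rule vars_At) (use assms in simp)
    with v consider j where "j \<in> {1..i}" "v \<in> set (Y j)"
      | j where "j \<in> {Suc i..n}" "v \<in> set (X j)" by blast
    then show False
    proof cases
      case 1
      then show False using * Y_Y_disjoint[of j "Suc k"] assms by auto
    next
      case 2
      then show False using * X_Y_disjoint[of j "Suc k"] assms by auto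
    qed
  qed
  then show "e' v = e v" using assms(3) by (simp add: variant_def)
qed

text \<open>Each class \<open>At i\<close> gets its own matching move \<open>h i\<close>. Distinct
  classes share no universal variable, so these moves can be glued into one.\<close>

lemma equivalent_step:
  assumes "equivalent k e p" "k < n" "variant (domain M) (X (Suc k)) e e'"
  obtains p' where "variant (domain M) (X (Suc k)) p p'"
    "\<And>i. i \<le> k \<Longrightarrow>
      fingerprint M (At i) (blocks (Suc k)) p' = fingerprint M (At i) (blocks (Suc k)) e'"
proof -
  have "\<exists>p'. variant (domain M) (X (Suc k)) p p' \<and>
      fingerprint M (At i) (blocks (Suc k)) p' = fingerprint M (At i) (blocks (Suc k)) e'"
    if "i \<le> k" for i
  proof -
    have "fingerprint M (At i) (X (Suc k) # blocks (Suc k)) e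
        = fingerprint M (At i) (X (Suc k) # blocks (Suc k)) p"
      using equivalent_fingerprint[OF assms(1) _ that] assms(2) blocks_less[of k] by simp
    from fingerprint_Cons_eqD[OF this _ assms(3)] finite_At[of i] that assms(2)
    show ?thesis by (metis le_trans less_imp_le)
  qed
  then obtain h where h: "\<And>i. i \<le> k \<Longrightarrow> variant (domain M) (X (Suc k)) p (h i)"
    "\<And>i. i \<le> k \<Longrightarrow>
      fingerprint M (At i) (blocks (Suc k)) (h i) = fingerprint M (At i) (blocks (Suc k)) e'"
    by metis
  \<comment> \<open>A variable of the block takes its value from the class in which it occurs; the
    default is its value under \<open>e'\<close>, which lies in the domain.\<close>
  define p' where "p' v = (if v \<in> set (X (Suc k))
    then if \<exists>i\<le>k. v \<in> vars (At i) then h (SOME i. i \<le> k \<and> v \<in> vars (At i)) v else e' v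
    else p v)" for v
  have p'_h: "p' v = h i v" if "i \<le> k" "v \<in> vars (At i)" for i v
  proof (cases "v \<in> set (X (Suc k))")
    case True
    define i' where "i' = (SOME i. i \<le> k \<and> v \<in> vars (At i))"
    have "i' \<le> k \<and> v \<in> vars (At i')"
      unfolding i'_def by (rule someI[of _ i]) (use that in simp)
    \<comment> \<open>By the second partition condition the class of a universal variable is unique,
      so \<open>SOME\<close> can only select \<open>i\<close>.\<close>
    then have "i' = i"
      using vars_At_disjoint[of i i' "Suc k"] True that assms(2) by auto
    then show ?thesis using True that unfolding p'_def i'_def by auto
  next
    case False
    then show ?thesis using h(1)[OF that(1)] by (simp add: p'_def variant_def)
  qed
  show ?thesis
  proof (rule that)
    show "variant (domain M) (X (Suc k)) p p'"
      unfolding variant_def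
    proof (intro conjI allI impI ballI)
      fix v assume "v \<notin> set (X (Suc k))"
      then show "p' v = p v" by (simp add: p'_def)
    next
      fix v assume v: "v \<in> set (X (Suc k))"
      show "p' v \<in> domain M"
      proof (cases "\<exists>i\<le>k. v \<in> vars (At i)")
        case True
        then show ?thesis using p'_h h(1) v by (auto simp: variant_def)
      next
        case False
        then have "p' v = e' v" using v by (auto simp: p'_def)
        then show ?thesis using assms(3) v by (simp add: variant_def)
      qed
    qed
    show "fingerprint M (At i) (blocks (Suc k)) p' = fingerprint M (At i) (blocks (Suc k)) e'"
      if "i \<le> k" for i
      using fingerprint_cong[of "At i" "blocks (Suc k)" p' "h i" M] p'_h h(2) that by simp
  qed
qed

section \<open>Finite sets of witnesses by downward induction on the round\<close>

text \<open>The witnesses \<open>D\<^sub>0\<close> are the answers of player \<open>\<exists>\<close> to one representative of every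
  combination of fingerprints that player \<open>\<forall>\<close> can produce. Fingerprints refer to all of \<open>M\<close>,
  also when the game is played on the smaller domain \<open>D\<close>.\<close>

lemma small_witness_set:
  assumes "k \<le> n" "sat M p (prenex_from k n X Y \<psi>)"
    and cv: "\<And>c. c \<in> set2_fm \<psi> \<Longrightarrow> cv c = const_val M c"
    and t: "\<And>i k e. i \<le> k \<Longrightarrow> k < n \<Longrightarrow> fingerprint M (At i) (blocks (Suc k)) e < t"
  shows "\<exists>D\<^sub>0. finite D\<^sub>0 \<and> D\<^sub>0 \<subseteq> domain M \<and>
    card D\<^sub>0 \<le> (\<Sum>j\<in>{Suc k..n}. length (Y j)) * t ^ (n\<^sup>2 - k\<^sup>2) \<and>
    (\<forall>D e. D\<^sub>0 \<subseteq> D \<and> D \<subseteq> domain M \<and> equivalent k e p \<longrightarrow>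
      sat (M\<lparr>domain := D, const_val := cv\<rparr>) e (prenex_from k n X Y \<psi>))"
  using assms(1,2)
proof (induction k arbitrary: p rule: inc_induct)
  \<comment> \<open>With no block left, fingerprints record just the true atoms, so equivalent
    positions agree on \<open>\<psi>\<close> and the empty set of witnesses suffices.\<close>
  case base
  have "sat (M\<lparr>domain := D, const_val := cv\<rparr>) e \<psi>" if "equivalent n e p" for D e
  proof -
    have "atm_holds M p a \<longleftrightarrow> atm_holds (M\<lparr>domain := D, const_val := cv\<rparr>) e a"
      if a: "a \<in> atoms \<psi>" for a
    proof -
      obtain i where i: "i \<le> n" "a \<in> At i" using Un_At a by fastforce
      have "atm_holds M e a \<longleftrightarrow> atm_holds M p a"
        using equivalent_fingerprint[OF \<open>equivalent n e p\<close> _ i(1)] finite_At i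
        by (intro fingerprint_Nil_eqD[of M "At i"]) auto
      moreover have "atm_holds (M\<lparr>domain := D, const_val := cv\<rparr>) e a \<longleftrightarrow> atm_holds M e a"
        by (rule atm_holds_restrict) (use cv set2_atm_atoms[OF a] in auto)
      ultimately show ?thesis by simp
    qed
    moreover have "qf_nnf \<psi>" using standard by (simp add: standard_form_def)
    ultimately show ?thesis using sat_qf_cong base by (metis prenex_from_self)
  qed
  then show ?case by (intro exI[of _ "{}"]) (simp add: prenex_from_self)
next
  case (step k)
  \<comment> \<open>Restriction to \<open>{..k}\<close> puts the combined fingerprints into a
    function space with \<open>t ^ Suc k\<close> elements, one factor for each class from
    \<open>0\<close> to \<open>k\<close>.\<close>
  let ?fp = "\<lambda>e. \<lambda>i\<in>{..k}. fingerprint M (At i) (blocks (Suc k)) e"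
  let ?s = "\<Sum>j\<in>{Suc (Suc k)..n}. length (Y j)"
  let ?b = "t ^ (n\<^sup>2 - (Suc k)\<^sup>2)"
  have win: "\<forall>p'. variant (domain M) (X (Suc k)) p p' \<longrightarrow>
      (\<exists>q. variant (domain M) (Y (Suc k)) p' q \<and> sat M q (prenex_from (Suc k) n X Y \<psi>))"
    using step.prems step.hyps
    by (simp add: prenex_from_less sat_foldr_Forall sat_foldr_Exists)
  define R where "R = ?fp ` Collect (variant (domain M) (X (Suc k)) p)"
  have R_sub: "R \<subseteq> {..k} \<rightarrow>\<^sub>E {..<t}"
    unfolding R_def
    by (rule image_subsetI) (use t step.hyps in \<open>simp add: restrict_PiE_iff del: upt_Suc\<close>)
  have fin_R: "finite R" by (rule finite_subset[OF R_sub]) (simp add: finite_PiE)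
  have "card R \<le> card ({..k} \<rightarrow>\<^sub>E {..<t})"
    by (rule card_mono[OF _ R_sub]) (simp add: finite_PiE)
  then have card_R: "card R \<le> t ^ Suc k" by (simp add: card_PiE)
  \<comment> \<open>\<open>q\<close> is the position after the answer to a representative move with
    fingerprints \<open>\<tau>\<close>, and \<open>D\<^sub>1\<close> contains the witnesses that the
    induction hypothesis supplies for \<open>q\<close>. The answer leaves \<open>\<tau>\<close>
    unchanged.\<close>
  define good where "good \<tau> q D\<^sub>1 \<longleftrightarrow>
      (\<forall>v. v \<notin> set (X (Suc k)) \<longrightarrow> v \<notin> set (Y (Suc k)) \<longrightarrow> q v = p v) \<and>
      q ` set (Y (Suc k)) \<subseteq> domain M \<and> ?fp q = \<tau> \<and>
      finite D\<^sub>1 \<and> D\<^sub>1 \<subseteq> domain M \<and> card D\<^sub>1 \<le> ?s * ?b \<and>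
      (\<forall>D e. D\<^sub>1 \<subseteq> D \<and> D \<subseteq> domain M \<and> equivalent (Suc k) e q \<longrightarrow>
        sat (M\<lparr>domain := D, const_val := cv\<rparr>) e (prenex_from (Suc k) n X Y \<psi>))" for \<tau> q D\<^sub>1
  have "\<exists>q D\<^sub>1. good \<tau> q D\<^sub>1"
    if \<tau>_R: "\<tau> \<in> R" for \<tau>
  proof -
    obtain p' where p': "variant (domain M) (X (Suc k)) p p'" "\<tau> = ?fp p'"
      using \<tau>_R unfolding R_def by blast
    then obtain q where q: "variant (domain M) (Y (Suc k)) p' q"
      "sat M q (prenex_from (Suc k) n X Y \<psi>)" using win by blast
    have "?fp q = \<tau>"
      unfolding p'(2) by (rule restrict_ext) (use fingerprint_variant_Y q step.hyps in blast)
    moreover have "\<forall>v. v \<notin> set (X (Suc k)) \<longrightarrow> v \<notin> set (Y (Suc k)) \<longrightarrow> q v = p v"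
      "q ` set (Y (Suc k)) \<subseteq> domain M"
      using p'(1) q(1) by (auto simp: variant_def)
    ultimately show ?thesis using step.IH[OF q(2)] unfolding good_def by blast
  qed
  then obtain q D\<^sub>1 where good: "\<And>\<tau>. \<tau> \<in> R \<Longrightarrow> good \<tau> (q \<tau>) (D\<^sub>1 \<tau>)" by metis
  have
    q: "\<And>\<tau> v. \<tau> \<in> R \<Longrightarrow> v \<notin> set (X (Suc k)) \<Longrightarrow> v \<notin> set (Y (Suc k)) \<Longrightarrow> q \<tau> v = p v"
      "\<And>\<tau>. \<tau> \<in> R \<Longrightarrow> q \<tau> ` set (Y (Suc k)) \<subseteq> domain M" "\<And>\<tau>. \<tau> \<in> R \<Longrightarrow> ?fp (q \<tau>) = \<tau>"
    and D\<^sub>1: "\<And>\<tau>. \<tau> \<in> R \<Longrightarrow> finite (D\<^sub>1 \<tau>)" "\<And>\<tau>. \<tau> \<in> R \<Longrightarrow> D\<^sub>1 \<tau> \<subseteq> domain M"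
      "\<And>\<tau>. \<tau> \<in> R \<Longrightarrow> card (D\<^sub>1 \<tau>) \<le> ?s * ?b"
      "\<And>\<tau> D e. \<tau> \<in> R \<Longrightarrow> D\<^sub>1 \<tau> \<subseteq> D \<Longrightarrow> D \<subseteq> domain M \<Longrightarrow> equivalent (Suc k) e (q \<tau>) \<Longrightarrow>
        sat (M\<lparr>domain := D, const_val := cv\<rparr>) e (prenex_from (Suc k) n X Y \<psi>)"
    using good unfolding good_def by blast+
  define D\<^sub>0 where "D\<^sub>0 = (\<Union>\<tau>\<in>R. q \<tau> ` set (Y (Suc k)) \<union> D\<^sub>1 \<tau>)"
  \<comment> \<open>Any fingerprint is a natural number below \<open>t\<close>.\<close>
  have "t > 0" using t[of k k p] step.hyps by linarith
  have "card (q \<tau> ` set (Y (Suc k)) \<union> D\<^sub>1 \<tau>) \<le> (length (Y (Suc k)) + ?s) * ?b" if "\<tau> \<in> R" for \<tau>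
  proof -
    have "card (q \<tau> ` set (Y (Suc k)) \<union> D\<^sub>1 \<tau>) \<le> card (q \<tau> ` set (Y (Suc k))) + card (D\<^sub>1 \<tau>)"
      by (rule card_Un_le)
    also have "card (q \<tau> ` set (Y (Suc k))) \<le> length (Y (Suc k))"
      by (metis card_image_le card_length finite_set le_trans)
    also have "length (Y (Suc k)) \<le> length (Y (Suc k)) * ?b" using \<open>t > 0\<close> by simp
    finally show ?thesis using D\<^sub>1(3)[OF that] by (simp add: algebra_simps)
  qed
  then have "card D\<^sub>0 \<le> (\<Sum>\<tau>\<in>R. (length (Y (Suc k)) + ?s) * ?b)"
    unfolding D\<^sub>0_def by (intro order_trans[OF card_UN_le[OF fin_R]] sum_mono)
  also have "\<dots> \<le> t ^ Suc k * ((length (Y (Suc k)) + ?s) * ?b)"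
    using card_R by (simp only: sum_constant mult_le_mono1 of_nat_id)
  also have "\<dots> = (length (Y (Suc k)) + ?s) * t ^ (Suc k + (n\<^sup>2 - (Suc k)\<^sup>2))"
    by (simp only: power_add ac_simps)
  also have "\<dots> \<le> (length (Y (Suc k)) + ?s) * t ^ (n\<^sup>2 - k\<^sup>2)"
  proof -
    \<comment> \<open>Round \<open>k + 1\<close> costs \<open>k + 1\<close> factors
      \<open>t\<close>, and \<open>k + 1\<close> is at most the difference \<open>2 * k + 1\<close>
      of the two squares. This first fact guards the truncated subtraction.\<close>
    have "(Suc k)\<^sup>2 \<le> n\<^sup>2" by (rule power_mono) (use step.hyps in auto)
    then have "Suc k + (n\<^sup>2 - (Suc k)\<^sup>2) \<le> n\<^sup>2 - k\<^sup>2" by (simp add: power2_eq_square)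
    then show ?thesis using \<open>t > 0\<close> by (intro mult_le_mono2 power_increasing) auto
  qed
  also have "length (Y (Suc k)) + ?s = (\<Sum>j\<in>{Suc k..n}. length (Y j))"
  proof -
    have "{Suc k..n} = insert (Suc k) {Suc (Suc k)..n}" using step.hyps by auto
    then show ?thesis by simp
  qed
  finally have card_D\<^sub>0: "card D\<^sub>0 \<le> (\<Sum>j\<in>{Suc k..n}. length (Y j)) * t ^ (n\<^sup>2 - k\<^sup>2)" .
  have "sat (M\<lparr>domain := D, const_val := cv\<rparr>) e (prenex_from k n X Y \<psi>)"
    if D: "D\<^sub>0 \<subseteq> D" "D \<subseteq> domain M" and ep: "equivalent k e p" for D e
  proof -
    \<comment> \<open>The move \<open>e'\<close> is matched by a move \<open>p'\<close> from
      \<open>p\<close>, and the answer stored for the fingerprints of \<open>p'\<close> is played;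
      it lies in \<open>D\<close>.\<close>
    have "\<exists>f. variant D (Y (Suc k)) e' f \<and>
        sat (M\<lparr>domain := D, const_val := cv\<rparr>) f (prenex_from (Suc k) n X Y \<psi>)"
      if e': "variant D (X (Suc k)) e e'" for e'
    proof -
      have "variant (domain M) (X (Suc k)) e e'" using e' D by (auto simp: variant_def)
      then obtain p' where p': "variant (domain M) (X (Suc k)) p p'"
        "\<And>i. i \<le> k \<Longrightarrow>
          fingerprint M (At i) (blocks (Suc k)) p' = fingerprint M (At i) (blocks (Suc k)) e'"
        using equivalent_step[OF ep] step.hyps by blast
      define \<tau> where "\<tau> = ?fp p'"
      have \<tau>: "\<tau> \<in> R" using p'(1) by (auto simp: \<tau>_def R_def)
      define f where "f v = (if v \<in> set (Y (Suc k)) then q \<tau> v else e' v)" for v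
      have "q \<tau> ` set (Y (Suc k)) \<subseteq> D" using D \<tau> by (auto simp: D\<^sub>0_def)
      then have f: "variant D (Y (Suc k)) e' f" by (auto simp: variant_def f_def)
      have "fingerprint M (At i) (blocks (Suc k)) f
          = fingerprint M (At i) (blocks (Suc k)) (q \<tau>)" if "i \<le> k" for i
      proof -
        have "fingerprint M (At i) (blocks (Suc k)) f = fingerprint M (At i) (blocks (Suc k)) e'"
          using fingerprint_variant_Y[OF that _ f] step.hyps by blast
        also have "\<dots> = \<tau> i" using p'(2)[OF that] that by (simp add: \<tau>_def del: upt_Suc)
        also have "\<dots> = ?fp (q \<tau>) i" using q(3)[OF \<tau>] by (simp only:)
        finally show ?thesis using that by (simp del: upt_Suc)
      qed
      \<comment> \<open>For earlier existential variables, \<open>e'\<close> agrees with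
        \<open>e\<close>, equivalence leads from \<open>e\<close> to \<open>p\<close>, and
        \<open>q \<tau>\<close> agrees with \<open>p\<close>.\<close>
      moreover have "f v = q \<tau> v" if "j \<in> {1..Suc k}" "v \<in> set (Y j)" for j v
      proof (cases "v \<in> set (Y (Suc k))")
        case True
        then show ?thesis by (simp add: f_def)
      next
        case False
        then have "j \<in> {1..k}" using that by (cases "j = Suc k") auto
        moreover have "v \<notin> set (X (Suc k))"
          using X_Y_disjoint[of "Suc k" j] that step.hyps by auto
        ultimately show ?thesis
          using False e' ep that q(1)[OF \<tau>] by (auto simp: f_def variant_def equivalent_def)
      qed
      ultimately have "equivalent (Suc k) f (q \<tau>)"
        by (auto simp: equivalent_def less_Suc_eq_le simp del: upt_Suc)
      moreover have "D\<^sub>1 \<tau> \<subseteq> D" using D \<tau> by (auto simp: D\<^sub>0_def)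
      ultimately show ?thesis using D\<^sub>1(4)[OF \<tau>] D f by blast
    qed
    then show ?thesis
      using step.hyps by (simp add: prenex_from_less sat_foldr_Forall sat_foldr_Exists)
  qed
  moreover have "finite D\<^sub>0" using fin_R D\<^sub>1(1) by (auto simp: D\<^sub>0_def)
  moreover have "D\<^sub>0 \<subseteq> domain M" using q(2) D\<^sub>1(2) unfolding D\<^sub>0_def by blast
  ultimately show ?case using card_D\<^sub>0 by blast
qed

end

section \<open>The finite submodel and its transfer to the natural numbers\<close>

theorem theorem5:
  fixes n :: nat
    and X Y :: "nat \<Rightarrow> 'v list"
    and \<phi> \<psi> :: "('v, 'c, 'p) fm"
    and At :: "nat \<Rightarrow> ('v, 'c, 'p) atm set"
    and M :: "('c, 'p, 'a) interp"
  assumes "\<phi> = prenex n X Y \<psi>"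
    and "standard_form n X Y \<psi>"
    and "gbsr_partition n X Y \<psi> At"
    and "1 \<le> degree n X At"
    and "is_model M \<phi>"
  shows "\<exists>N :: ('c, 'p, nat) interp.
           is_model N \<phi> \<and> finite (domain N) \<and>
           card (domain N) \<le> (len \<phi>)\<^sup>2 * (twoup (degree n X At + 1) (len \<phi>)) ^ (n\<^sup>2)"
proof -
  interpret gbsr n X Y \<psi> At M by standard (use assms in auto)
  define t where "t = twoup (degree n X At + 1) (len \<phi>)"
  have \<phi>: "\<phi> = prenex_from 0 n X Y \<psi>" by (simp add: assms(1) prenex_from_0)
  have len: "(\<Sum>j\<in>{Suc 0..n}. length (Y j)) + len \<psi> \<le> len \<phi>"
    unfolding \<phi> by (rule len_prenex_from) simp
  have "t > 0" by (simp add: t_def)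
  from assms(5) obtain d where d: "d \<in> domain M" and wf: "\<And>c. const_val M c \<in> domain M"
    by (auto simp: is_model_def wf_interp_def)
  \<comment> \<open>Constants outside \<open>\<psi>\<close> also need values in the finite domain;
    all are sent to \<open>d\<close>, which belongs to \<open>D\<close> and keeps it
    nonempty.\<close>
  define cv where "cv c = (if c \<in> set2_fm \<psi> then const_val M c else d)" for c
  have "sat M (\<lambda>_. d) \<phi>" using assms(5) d by (auto simp: is_model_def)
  moreover have "fingerprint M (At i) (map X [Suc (Suc k)..<Suc n]) e < t"
    if "i \<le> k" "k < n" for i k e
    unfolding t_def using that
    by (rule fingerprint_bound) (use card_atoms_le_len[of \<psi>] len in linarith)
  ultimately obtain D\<^sub>0 where D\<^sub>0: "finite D\<^sub>0" "D\<^sub>0 \<subseteq> domain M"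
    "card D\<^sub>0 \<le> (\<Sum>j\<in>{Suc 0..n}. length (Y j)) * t ^ (n\<^sup>2)"
    "\<And>D e. D\<^sub>0 \<subseteq> D \<Longrightarrow> D \<subseteq> domain M \<Longrightarrow> equivalent 0 e (\<lambda>_. d) \<Longrightarrow>
      sat (M\<lparr>domain := D, const_val := cv\<rparr>) e \<phi>"
    using small_witness_set[of 0 "\<lambda>_. d" cv t] unfolding \<phi> by (auto simp: cv_def simp del: upt_Suc)
  define D where "D = insert d (const_val M ` set2_fm \<psi>) \<union> D\<^sub>0"
  have fin: "finite D" using D\<^sub>0(1) by (simp add: D_def finite_fm_consts)
  have cv_D: "cv c \<in> D" for c by (simp add: cv_def D_def)
  let ?M = "M\<lparr>domain := D, const_val := cv\<rparr>"
  \<comment> \<open>Before the first round the index ranges in \<open>equivalent\<close> are empty,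
    so every assignment is equivalent to the constant one.\<close>
  have sat: "sat ?M e \<phi>" for e
    by (rule D\<^sub>0(4)) (use D\<^sub>0(2) d wf in \<open>auto simp: D_def equivalent_def\<close>)
  have "card D \<le> card (insert d (const_val M ` set2_fm \<psi>)) + card D\<^sub>0"
    unfolding D_def by (rule card_Un_le)
  also have "card (insert d (const_val M ` set2_fm \<psi>)) \<le> Suc (card (set2_fm \<psi>))"
    using card_image_le[OF finite_fm_consts, of "const_val M" \<psi>]
    by (simp add: card_insert_if finite_fm_consts)
  also have "\<dots> \<le> len \<psi>" using card_fm_consts_less_len by (rule Suc_leI)
  also have "len \<psi> \<le> len \<psi> * t ^ (n\<^sup>2)" using \<open>t > 0\<close> by simp
  finally have "card D \<le> (len \<psi> + (\<Sum>j\<in>{Suc 0..n}. length (Y j))) * t ^ (n\<^sup>2)"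
    using D\<^sub>0(3) by (simp add: algebra_simps)
  also have "\<dots> \<le> (len \<phi>)\<^sup>2 * t ^ (n\<^sup>2)"
  proof (rule mult_le_mono1)
    \<comment> \<open>The count so far is linear in \<open>len \<phi>\<close> and is weakened to the
      square.\<close>
    have "len \<phi> \<le> (len \<phi>)\<^sup>2" by (simp add: power2_eq_square)
    then show "len \<psi> + (\<Sum>j\<in>{Suc 0..n}. length (Y j)) \<le> (len \<phi>)\<^sup>2" using len by linarith
  qed
  finally have card_D: "card D \<le> (len \<phi>)\<^sup>2 * t ^ (n\<^sup>2)" .
  obtain h where h: "bij_betw h D {0..<card D}" using ex_bij_betw_finite_nat[OF fin] by blast
  define g where "g = inv_into D h"
  have g: "bij_betw g {0..<card D} D" unfolding g_def using h by (rule bij_betw_inv_into)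
  \<comment> \<open>Relations are pulled back along \<open>g\<close>, which makes \<open>g\<close>
    an isomorphism from \<open>N\<close> onto the submodel.\<close>
  define N :: "('c, 'p, nat) interp" where
    "N = \<lparr>domain = {0..<card D}, const_val = h \<circ> cv, rel_val = \<lambda>p as. rel_val M p (map g as)\<rparr>"
  have h_cv: "h (cv c) \<in> {0..<card D}" for c using h cv_D by (auto simp: bij_betw_def)
  have g_cv: "g (h (cv c)) = cv c" for c
    unfolding g_def using h cv_D by (simp add: bij_betw_def inv_into_f_f)
  have "sat N e \<phi>" if "range e \<subseteq> domain N" for e
    using sat_isomorphic[of g N ?M e \<phi>] that sat g h_cv g_cv by (auto simp: N_def)
  moreover have "wf_interp N"
    using h_cv fin by (auto simp: wf_interp_def N_def D_def card_gt_0_iff)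
  ultimately have "is_model N \<phi>" by (simp add: is_model_def)
  moreover have "finite (domain N)" "card (domain N) = card D" by (simp_all add: N_def)
  ultimately show ?thesis using card_D unfolding t_def by metis
qed

end
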